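(* For every integer $n\geq 2$, the number of random walk labelings of the torus graph $C_2\times C_n$ is $$\mathcal{L}(C_2\times C_n)=\frac{n(n+2)(2n-2)!}{(n-2)!}.$$
   Context: Let $G$ be a finite connected undirected graph with vertex set $V$. A random walk labeling of $G$ is a labeling of $V$ obtainable by the following process: (1) set $i=1$, choose $v\in V$, and label $v$ with $i$; (2) as long as there are unlabeled vertices, pick $w\in V$ adjacent to $v$ and replace $v$ with $w$; if (the new) $v$ is not labeled, increase $i$ by $1$ and label $v$ with $i$. (Thus vertices are labeled $1,\ldots,|V|$ in the order of their first visit by a walk on $G$.) The number of distinct random walk labelings of $G$ is denoted $\mathcal{L}(G)$. Here $\times$ denotes the Cartesian product of graphs, $C_n$ is the cycle on $n$ vertices, and $C_2$ is identified with the path $P_2$ on two vertices (a single edge). So $C_2\times C_n$ has vertex set $\{0,1\}\times \mathbb{Z}/n\mathbb{Z}$, with $(r,i)$ adjacent to $(1-r,i)$, $(r,i+1)$ and $(r,i-1)$ for all $r,i$ (as a simple graph). *)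

theory Defs
  imports Complex_Main "Graph_Theory.Pair_Digraph"
begin

text \<open>
  A finite simple undirected graph is a \<^locale>\<open>pair_graph\<close>: finite, loop-free, and with a
  symmetric arc relation, an edge between u and v being the two arcs (u,v) and (v,u).
\<close>

text \<open>
  Vertices 0, ..., n-1 with i adjacent to i+1 and i-1 modulo n. Since arcs form a set,
  C_2 comes out as a single edge, i.e. as the path on two vertices. The
  condition i \<noteq> j only matters for n = 1.
\<close>

definition cycle_graph :: "nat \<Rightarrow> nat pair_pre_digraph" where
  "cycle_graph n =
     \<lparr> pverts = {..<n},
       parcs = {(i, j). i < n \<and> j < n \<and> i \<noteq> j \<and> (j = (i + 1) mod n \<or> i = (j + 1) mod n)} \<rparr>"

definition cart_prod :: "'a pair_pre_digraph \<Rightarrow> 'b pair_pre_digraph \<Rightarrow> ('a \<times> 'b) pair_pre_digraph"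
  where
  "cart_prod G H =
     \<lparr> pverts = pverts G \<times> pverts H,
       parcs = {((a, b), (a', b')) | a b a' b'.
                  (a = a' \<and> a \<in> pverts G \<and> (b, b') \<in> parcs H) \<or>
                  ((a, a') \<in> parcs G \<and> b = b' \<and> b \<in> pverts H)} \<rparr>"

text \<open>
  The states of the labeling process: \<open>rw_state G v i l\<close> says that the walk can
  be at vertex v when i is the largest label used and l is the current partial labeling.
\<close>

inductive rw_state :: "'a pair_pre_digraph \<Rightarrow> 'a \<Rightarrow> nat \<Rightarrow> ('a \<rightharpoonup> nat) \<Rightarrow> bool"
  for G :: "'a pair_pre_digraph" where
  start: "v \<in> pverts G \<Longrightarrow> rw_state G v 1 [v \<mapsto> 1]"
| revisit: "\<lbrakk>rw_state G v i l; pverts G - dom l \<noteq> {}; (v, w) \<in> parcs G; w \<in> dom l\<rbrakk>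
    \<Longrightarrow> rw_state G w i l"
| visit: "\<lbrakk>rw_state G v i l; pverts G - dom l \<noteq> {}; (v, w) \<in> parcs G; w \<notin> dom l\<rbrakk>
    \<Longrightarrow> rw_state G w (i + 1) (l(w \<mapsto> i + 1))"

definition rw_labelings :: "'a pair_pre_digraph \<Rightarrow> ('a \<rightharpoonup> nat) set" where
  "rw_labelings G = {l. dom l = pverts G \<and> (\<exists>v i. rw_state G v i l)}"

definition num_rw_labelings :: "'a pair_pre_digraph \<Rightarrow> nat" where
  "num_rw_labelings G = card (rw_labelings G)"

lemma pair_graph_cycle_graph: "pair_graph (cycle_graph n)"
proof
  show "finite (parcs (cycle_graph n))"
    by (rule finite_subset[of _ "{..<n} \<times> {..<n}"]) (auto simp: cycle_graph_def)
qed (auto simp: cycle_graph_def symmetric_def intro!: symI)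

lemma pair_graph_cart_prod:
  assumes "pair_graph G" "pair_graph H"
  shows "pair_graph (cart_prod G H)"
proof -
  interpret G: pair_graph G by fact
  interpret H: pair_graph H by fact
  have sub: "parcs (cart_prod G H) \<subseteq> (pverts G \<times> pverts H) \<times> (pverts G \<times> pverts H)"
    by (auto simp: cart_prod_def dest: G.in_arcsD1 G.in_arcsD2 H.in_arcsD1 H.in_arcsD2)
  have symG: "(x, y) \<in> parcs G \<Longrightarrow> (y, x) \<in> parcs G" for x y
    using G.pair_sym_arcs by (auto simp: symmetric_def dest: symD)
  have symH: "(x, y) \<in> parcs H \<Longrightarrow> (y, x) \<in> parcs H" for x y
    using H.pair_sym_arcs by (auto simp: symmetric_def dest: symD)
  have fin: "finite (pverts G \<times> pverts H)"
    using G.pair_finite_verts H.pair_finite_verts by simp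
  show ?thesis
  proof
    show "finite (pverts (cart_prod G H))" using fin by (simp add: cart_prod_def)
    show "finite (parcs (cart_prod G H))" using sub fin by (meson finite_SigmaI finite_subset)
    show "symmetric (with_proj (cart_prod G H))"
      by (auto simp: cart_prod_def symmetric_def symG symH intro!: symI)
  next
    fix e assume e: "e \<in> parcs (cart_prod G H)"
    show "fst e \<in> pverts (cart_prod G H)" "snd e \<in> pverts (cart_prod G H)"
      using subsetD[OF sub e] by (auto simp: cart_prod_def)
    show "fst e \<noteq> snd e"
      using e G.pair_no_loops H.pair_no_loops by (fastforce simp: cart_prod_def)
  qed
qed

end

theory Submission
  imports Defs
begin

text \<open>
  A labeling is obtainable iff every vertex after the first is adjacent to an earlier one, so the
  task is to count the orders in which a set can grow through its vertex boundary to the whole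
  prism. While some column is untouched, the touched columns form an arc. The key point is that the
  fraction of all orders of the remaining vertices that are admissible depends only on the
  number of untouched columns and on the parts of the two end columns of the arc that are covered.
  This fraction has a closed form, verified by induction on the number of remaining vertices.
\<close>

section \<open>Labelings as growth sequences\<close>

definition boundary :: "'a pair_pre_digraph \<Rightarrow> 'a set \<Rightarrow> 'a set" where
  "boundary G S = {w \<in> pverts G - S. \<exists>v\<in>S. (v, w) \<in> parcs G}"

definition growth_step :: "'a pair_pre_digraph \<Rightarrow> ('a \<rightharpoonup> nat) \<Rightarrow> ('a \<rightharpoonup> nat) \<Rightarrow> bool" where
  "growth_step G l l' \<longleftrightarrow> (\<exists>w\<in>boundary G (dom l). l' = l(w \<mapsto> card (dom l) + 1))"

definition full_growths :: "'a pair_pre_digraph \<Rightarrow> ('a \<rightharpoonup> nat) \<Rightarrow> ('a \<rightharpoonup> nat) set" where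
  "full_growths G l = {l'. (growth_step G)\<^sup>*\<^sup>* l l' \<and> dom l' = pverts G}"

text \<open>The number of orders in which the vertices outside \<open>S\<close> can be added, each
  lying on the boundary of the set present at that moment. A completed set leaves one empty order,
  and a dead end gives the empty sum 0. The infinite case is a dummy value that makes the recursion
  terminate.\<close>

function completions :: "'a pair_pre_digraph \<Rightarrow> 'a set \<Rightarrow> nat" where
  "completions G S =
     (if infinite (pverts G) \<or> pverts G \<subseteq> S then 1
      else \<Sum>w\<in>boundary G S. completions G (insert w S))"
  by pat_completeness auto
termination
proof (relation "measure (\<lambda>(G, S). card (pverts G - S))", goal_cases)
  case (2 G S w)
  then have "pverts G - insert w S \<subset> pverts G - S" by (auto simp: boundary_def)
  then show ?case using 2 by (auto intro: psubset_card_mono)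
qed simp

declare completions.simps [simp del]

text \<open>Steps only add entries, each labeled with one more than the current domain size. Hence a
  later labeling still reveals which vertex was added right after \<open>l\<close>; the disjointness
  below rests on this.\<close>

lemma growths_extend:
  assumes "(growth_step G)\<^sup>*\<^sup>* l l'" "finite (dom l)"
  shows "finite (dom l') \<and> card (dom l) \<le> card (dom l') \<and> (\<forall>x\<in>dom l. l' x = l x) \<and>
    (\<forall>x i. x \<notin> dom l \<longrightarrow> l' x = Some i \<longrightarrow> card (dom l) < i)"
  using assms
proof (induction rule: rtranclp_induct)
  case base
  then show ?case by auto
next
  case (step l1 l2)
  obtain w where w: "w \<in> boundary G (dom l1)" "l2 = l1(w \<mapsto> card (dom l1) + 1)"
    using step.hyps by (auto simp: growth_step_def)
  have wn: "w \<notin> dom l1" using w by (auto simp: boundary_def)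
  note IH = step.IH[OF step.prems]
  have wl: "w \<notin> dom l" using IH wn by (metis domIff)
  have "dom l2 = insert w (dom l1)" "card (insert w (dom l1)) = Suc (card (dom l1))"
    using IH wn w(2) by simp_all
  then have "finite (dom l2)" "card (dom l) \<le> card (dom l2)" using IH by simp_all
  moreover have "\<forall>x\<in>dom l. l2 x = l x"
    "\<forall>x i. x \<notin> dom l \<longrightarrow> l2 x = Some i \<longrightarrow> card (dom l) < i"
    using IH wl w(2) by auto
  ultimately show ?case by blast
qed

lemma full_growths_step:
  assumes "dom l \<noteq> pverts G"
  shows "full_growths G l =
    (\<Union>w\<in>boundary G (dom l). full_growths G (l(w \<mapsto> card (dom l) + 1)))"
proof (intro set_eqI iffI)
  fix l' assume "l' \<in> full_growths G l"
  then have l': "(growth_step G)\<^sup>*\<^sup>* l l'" "dom l' = pverts G" by (auto simp: full_growths_def)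
  from l'(1) show "l' \<in> (\<Union>w\<in>boundary G (dom l). full_growths G (l(w \<mapsto> card (dom l) + 1)))"
  proof (cases rule: converse_rtranclpE)
    case base
    then show ?thesis using assms l'(2) by simp
  next
    case (step y)
    then show ?thesis using l'(2) by (auto simp: growth_step_def full_growths_def)
  qed
next
  fix l' assume "l' \<in> (\<Union>w\<in>boundary G (dom l). full_growths G (l(w \<mapsto> card (dom l) + 1)))"
  then obtain w where w: "w \<in> boundary G (dom l)"
    and r: "(growth_step G)\<^sup>*\<^sup>* (l(w \<mapsto> card (dom l) + 1)) l'" "dom l' = pverts G"
    by (auto simp: full_growths_def)
  have "growth_step G l (l(w \<mapsto> card (dom l) + 1))" using w by (auto simp: growth_step_def)
  then show "l' \<in> full_growths G l"
    using r by (simp add: full_growths_def converse_rtranclp_into_rtranclp)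
qed

text \<open>In the second family \<open>w'\<close> carries the label
  \<open>card (dom l) + 1\<close>; in the first it can only be added after \<open>w\<close>, so its
  label is larger.\<close>

lemma full_growths_disjoint:
  assumes fin: "finite (dom l)" and ww': "w \<notin> dom l" "w' \<notin> dom l" "w \<noteq> w'"
  shows "full_growths G (l(w \<mapsto> card (dom l) + 1)) \<inter>
    full_growths G (l(w' \<mapsto> card (dom l) + 1)) = {}"
proof (rule ccontr)
  let ?l = "\<lambda>w. l(w \<mapsto> card (dom l) + 1)"
  assume "\<not> ?thesis"
  then obtain l' where l': "(growth_step G)\<^sup>*\<^sup>* (?l w) l'" "(growth_step G)\<^sup>*\<^sup>* (?l w') l'"
    by (auto simp: full_growths_def)
  have 1: "l' w' = Some (card (dom l) + 1)"
    using growths_extend[OF l'(2)] fin by simp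
  have "w' \<notin> dom (?l w)" using ww' by auto
  then have "card (dom (?l w)) < card (dom l) + 1"
    using growths_extend[OF l'(1)] fin 1 by auto
  then show False using fin ww' by simp
qed

text \<open>Splitting the full growths by the first vertex added gives a disjoint union, so their
  number obeys the recursion of \<open>completions\<close>.\<close>

lemma card_full_growths:
  assumes fin: "finite (pverts G)" and "dom l \<subseteq> pverts G"
  shows "finite (full_growths G l) \<and> card (full_growths G l) = completions G (dom l)"
  using assms(2)
proof (induction "card (pverts G - dom l)" arbitrary: l rule: less_induct)
  case less
  have finl: "finite (dom l)" using less.prems fin finite_subset by blast
  show ?case
  proof (cases "dom l = pverts G")
    case True
    have "l' = l" if "(growth_step G)\<^sup>*\<^sup>* l l'" for l'
      using that by (cases rule: converse_rtranclpE) (auto simp: growth_step_def boundary_def True)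
    then have "full_growths G l = {l}" using True by (auto simp: full_growths_def)
    then show ?thesis using True fin by (simp add: completions.simps)
  next
    case False
    let ?l = "\<lambda>w. l(w \<mapsto> card (dom l) + 1)"
    have IH: "finite (full_growths G (?l w)) \<and>
        card (full_growths G (?l w)) = completions G (insert w (dom l))"
      if "w \<in> boundary G (dom l)" for w
    proof -
      have w: "w \<in> pverts G" "w \<notin> dom l" using that by (auto simp: boundary_def)
      then have "pverts G - dom (?l w) \<subset> pverts G - dom l" by auto
      then have "card (pverts G - dom (?l w)) < card (pverts G - dom l)"
        using fin by (intro psubset_card_mono) auto
      from less.hyps[OF this] show ?thesis using less.prems w by simp
    qed
    have finb: "finite (boundary G (dom l))" using fin by (simp add: boundary_def)
    have eq: "full_growths G l = (\<Union>w\<in>boundary G (dom l). full_growths G (?l w))"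
      by (rule full_growths_step[OF False])
    have "card (full_growths G l) = (\<Sum>w\<in>boundary G (dom l). card (full_growths G (?l w)))"
      unfolding eq
    proof (rule card_UN_disjoint[OF finb])
      show "\<forall>w\<in>boundary G (dom l). \<forall>w'\<in>boundary G (dom l). w \<noteq> w' \<longrightarrow>
          full_growths G (?l w) \<inter> full_growths G (?l w') = {}"
        by (intro ballI impI full_growths_disjoint[OF finl]) (auto simp: boundary_def)
    qed (use IH in blast)
    also have "\<dots> = completions G (dom l)"
      using IH False fin less.prems by (subst completions.simps) (auto intro!: sum.cong)
    finally show ?thesis using IH finb unfolding eq by blast
  qed
qed

section \<open>Random walks compared with growth sequences\<close>

lemma rw_state_revisit_path:
  assumes "(x, y) \<in> (parcs G \<inter> S \<times> S)\<^sup>*" "S \<subseteq> dom l" "pverts G - dom l \<noteq> {}" "rw_state G x i l"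
  shows "rw_state G y i l"
  using assms
proof (induction rule: rtrancl_induct)
  case (step y z)
  then show ?case by (intro rw_state.revisit[of G y i l z]) auto
qed

text \<open>The walk can realize every growth step because it may first wander through labeled
  vertices to a neighbour of the vertex to be added. The induction therefore also carries
  connectedness of the labeled set within itself.\<close>

lemma growth_imp_rw_state:
  assumes G: "pair_graph G" and v: "v \<in> pverts G" and r: "(growth_step G)\<^sup>*\<^sup>* [v \<mapsto> 1] l"
  shows "(\<exists>x\<in>dom l. rw_state G x (card (dom l)) l) \<and> finite (dom l) \<and>
    (\<forall>x\<in>dom l. \<forall>y\<in>dom l. (x, y) \<in> (parcs G \<inter> dom l \<times> dom l)\<^sup>*)"
  using r
proof (induction rule: rtranclp_induct)
  case base
  have d: "dom [v \<mapsto> 1] = {v}" by simp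
  show ?case using rw_state.start[OF v] unfolding d by (simp del: fun_upd_apply)
next
  case (step l l')
  interpret pair_graph G by fact
  obtain w where w: "w \<in> boundary G (dom l)" "l' = l(w \<mapsto> card (dom l) + 1)"
    using step.hyps by (auto simp: growth_step_def)
  obtain u where u: "u \<in> dom l" "(u, w) \<in> parcs G" and wn: "w \<in> pverts G" "w \<notin> dom l"
    using w(1) by (auto simp: boundary_def)
  have wu: "(w, u) \<in> parcs G" using u pair_sym_arcs by (auto simp: symmetric_def dest: symD)
  obtain x where x: "x \<in> dom l" "rw_state G x (card (dom l)) l" using step.IH by blast
  have ne: "pverts G - dom l \<noteq> {}" using wn by auto
  \<comment> \<open>Walk back inside the labeled set to \<open>u\<close>, without changing the
    labeling; the next move labels \<open>w\<close>.\<close>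
  have "rw_state G u (card (dom l)) l"
    using rw_state_revisit_path[of x u G "dom l"] x ne u(1) step.IH by blast
  then have st: "rw_state G w (card (dom l) + 1) l'"
    using rw_state.visit ne u(2) wn w(2) by metis
  have dom': "dom l' = insert w (dom l)" using w by simp
  let ?R = "(parcs G \<inter> dom l' \<times> dom l')\<^sup>*"
  have sub: "(parcs G \<inter> dom l \<times> dom l)\<^sup>* \<subseteq> ?R" by (rule rtrancl_mono) (auto simp: dom')
  \<comment> \<open>\<open>u\<close> serves as a hub: every labeled vertex reaches it and is reached
    from it.\<close>
  have "(y, u) \<in> ?R \<and> (u, y) \<in> ?R" if "y \<in> dom l'" for y
    using that step.IH sub u wu unfolding dom' by auto
  then have "(y, z) \<in> ?R" if "y \<in> dom l'" "z \<in> dom l'" for y z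
    using that by (meson rtrancl_trans)
  moreover have "card (dom l') = card (dom l) + 1" using step.IH wn dom' by simp
  ultimately show ?case using st step.IH dom' by auto
qed

text \<open>A revisit keeps the labeling and a visit is one growth step; the invariant
  \<open>i = card (dom l)\<close> makes the two labeling rules agree.\<close>

lemma rw_state_imp_growth:
  assumes G: "pair_graph G" and "rw_state G v i l"
  shows "(\<exists>v0\<in>pverts G. (growth_step G)\<^sup>*\<^sup>* [v0 \<mapsto> 1] l) \<and> v \<in> dom l \<and> finite (dom l) \<and>
    i = card (dom l)"
  using assms(2)
proof induction
  case (start v)
  have d: "dom [v \<mapsto> 1] = {v}" by simp
  show ?case using start unfolding d by auto
next
  case (revisit v i l w)
  then show ?case by blast
next
  case (visit v i l w)
  interpret pair_graph G by fact
  have "w \<in> pverts G" using visit.hyps in_arcsD2 by blast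
  then have "w \<in> boundary G (dom l)" using visit by (auto simp: boundary_def)
  then have "growth_step G l (l(w \<mapsto> i + 1))" using visit.IH by (auto simp: growth_step_def)
  then have "\<exists>v0\<in>pverts G. (growth_step G)\<^sup>*\<^sup>* [v0 \<mapsto> 1] (l(w \<mapsto> i + 1))"
    using visit.IH by (meson rtranclp.rtrancl_into_rtrancl)
  moreover have "dom (l(w \<mapsto> i + 1)) = insert w (dom l)" by simp
  ultimately show ?case using visit by (simp del: fun_upd_apply)
qed

lemma rw_labelings_eq:
  assumes "pair_graph G"
  shows "rw_labelings G = (\<Union>v\<in>pverts G. full_growths G [v \<mapsto> 1])"
proof (intro set_eqI iffI)
  fix l assume "l \<in> rw_labelings G"
  then show "l \<in> (\<Union>v\<in>pverts G. full_growths G [v \<mapsto> 1])"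
    using rw_state_imp_growth[OF assms] by (fastforce simp: rw_labelings_def full_growths_def)
next
  fix l assume "l \<in> (\<Union>v\<in>pverts G. full_growths G [v \<mapsto> 1])"
  then show "l \<in> rw_labelings G"
    using growth_imp_rw_state[OF assms, of _ l] by (fastforce simp: rw_labelings_def full_growths_def)
qed

lemma num_rw_labelings_eq:
  assumes "pair_graph G"
  shows "num_rw_labelings G = (\<Sum>v\<in>pverts G. completions G {v})"
proof -
  interpret pair_graph G by fact
  have fg: "finite (full_growths G [v \<mapsto> 1])" "card (full_growths G [v \<mapsto> 1]) = completions G {v}"
    if "v \<in> pverts G" for v
    using card_full_growths[OF pair_finite_verts, of "[v \<mapsto> 1]"] that by auto
  have "num_rw_labelings G = (\<Sum>v\<in>pverts G. card (full_growths G [v \<mapsto> 1]))"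
    unfolding num_rw_labelings_def rw_labelings_eq[OF assms]
  proof (rule card_UN_disjoint)
    show "\<forall>v\<in>pverts G. \<forall>w\<in>pverts G. v \<noteq> w \<longrightarrow>
        full_growths G [v \<mapsto> 1] \<inter> full_growths G [w \<mapsto> 1] = {}"
      \<comment> \<open>Choosing the start vertex is an extension of the empty labeling, whose
        domain size 0 yields the label 1.\<close>
      using full_growths_disjoint[of Map.empty _ _ G] by simp
  qed (use fg pair_finite_verts in auto)
  then show ?thesis using fg by simp
qed

section \<open>Growth on the prism\<close>

definition arc :: "nat \<Rightarrow> nat \<Rightarrow> nat \<Rightarrow> nat set" where
  "arc n a m = (\<lambda>k. (a + k) mod n) ` {..<m}"

abbreviation prism :: "nat \<Rightarrow> (nat \<times> nat) pair_pre_digraph" where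
  "prism n \<equiv> cart_prod (cycle_graph 2) (cycle_graph n)"

definition rows :: "(nat \<times> nat) set \<Rightarrow> nat \<Rightarrow> nat set" where
  "rows S j = {r. (r, j) \<in> S}"

text \<open>
  The fraction of admissible orders, for \<open>u\<close> untouched columns and covered parts \<open>A\<close>, \<open>B\<close> of
  the end columns. It is the solution of the recurrence \<open>weight_rec\<close>. For \<open>u = 0\<close> the
  values are not fractions (the true one is 1): when a single column is left, extending the arc to
  the left and to the right reaches the same vertices, and the values at 0 compensate
  for this double counting, see \<open>weight_0\<close>.
\<close>

definition weight :: "nat \<Rightarrow> nat set \<Rightarrow> nat set \<Rightarrow> real" where
  "weight u A B =
     (if card A + card B = 4 then real u
      else if card A + card B = 3 then (real u + 1) / 2
      else if A = B then (real u + 2) / 4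
      else ((real u)\<^sup>2 + 3 * real u + 4) / (4 * (real u + 1))) / fact u"

definition end_rows :: "nat set set" where
  "end_rows = {{0}, {1}, {0, 1}}"

text \<open>Let R be the number of uncovered vertices. Dividing the recursion of
  \<open>completions\<close> by (R - 1)! says that R times the fraction is the sum of the fractions
  after each possible addition. Additions to touched columns other than the ends leave the fraction
  unchanged and cancel against their share of R. What remains are the fillings of an end column and
  the openings of a new column, which becomes an end \<open>{r}\<close>.\<close>

lemma weight_rec:
  assumes "A \<in> end_rows" "B \<in> end_rows"
  shows "(2 * real (Suc u) + card ({0, 1} - A) + card ({0, 1} - B)) * weight (Suc u) A B =
    (\<Sum>r\<in>{0, 1} - A. weight (Suc u) (insert r A) B) +
    (\<Sum>r\<in>{0, 1} - B. weight (Suc u) A (insert r B)) +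
    (\<Sum>r\<in>A. weight u {r} B) + (\<Sum>r\<in>B. weight u A {r})"
proof -
  define x where "x = real u"
  \<comment> \<open>Nonvanishing of denominators, so that \<open>divide_simps\<close> can clear the
    fractions and leave polynomial identities in \<open>x\<close>.\<close>
  have x: "real u = x" "1 + x \<noteq> 0" "2 + x \<noteq> 0"
    "2 + x * 2 \<noteq> 0" "4 + x * 4 \<noteq> 0" "8 + x * 4 \<noteq> 0"
    by (auto simp: x_def)
  have D: "{0, Suc 0} - {0} = {Suc 0}" "{0, Suc 0} - {Suc 0} = {0}" by auto
  have I: "insert (Suc 0) {0} = {0, Suc 0}" by auto
  show ?thesis
    using assms unfolding end_rows_def insert_iff empty_iff simp_thms
    by (elim disjE, simp_all add: weight_def D I x(1), simp_all add: divide_simps x)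
      (simp_all add: algebra_simps power2_eq_square x)
qed

text \<open>The last untouched column can be entered exactly in the rows of
  \<open>A \<union> B\<close>, and afterwards every order is admissible. The sum over both ends must
  therefore count a row common to \<open>A\<close> and \<open>B\<close> only once.\<close>

lemma weight_0:
  assumes "A \<in> end_rows" "B \<in> end_rows"
  shows "(\<Sum>r\<in>A. weight 0 {r} B) + (\<Sum>r\<in>B. weight 0 A {r}) = card (A \<union> B)"
  using assms unfolding end_rows_def by (auto simp: weight_def insert_commute)

definition touching :: "nat \<Rightarrow> nat \<Rightarrow> nat \<Rightarrow> (nat \<times> nat) set \<Rightarrow> bool" where
  "touching n a m S \<longleftrightarrow> S \<subseteq> {0, 1} \<times> {..<n} \<and> snd ` S = arc n a m"

lemma pverts_prism: "pverts (prism n) = {0, 1} \<times> {..<n}"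
  by (auto simp: cart_prod_def cycle_graph_def)

lemma parcs_prism:
  "((r, i), (s, j)) \<in> parcs (prism n) \<longleftrightarrow>
     r \<in> {0, 1} \<and> s \<in> {0, 1} \<and> i < n \<and> j < n \<and>
     (r = s \<and> i \<noteq> j \<and> (j = (i + 1) mod n \<or> i = (j + 1) mod n) \<or> r \<noteq> s \<and> i = j)"
  by (auto simp: cart_prod_def cycle_graph_def less_2_cases_iff)

section \<open>Arithmetic of arcs in the cycle\<close>

lemma arc_Suc: "arc n a (Suc m) = insert ((a + m) mod n) (arc n a m)"
  by (simp add: arc_def lessThan_Suc)

text \<open>Extension to the left moves the start to the predecessor of \<open>a\<close>, written
  with \<open>a + n - 1\<close> so that subtraction does not truncate at
  \<open>a = 0\<close>.\<close>

lemma arc_pred: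
  assumes "0 < n"
  shows "arc n ((a + n - 1) mod n) (Suc m) = insert ((a + n - 1) mod n) (arc n a m)"
proof -
  have "((a + n - 1) mod n + Suc k) mod n = (a + k) mod n" for k
  proof -
    have "((a + n - 1) mod n + Suc k) mod n = (a + n - 1 + Suc k) mod n"
      by (rule mod_add_left_eq)
    also have "a + n - 1 + Suc k = a + k + n" using assms by simp
    finally show ?thesis by simp
  qed
  then show ?thesis by (simp add: arc_def lessThan_Suc_eq_insert_0 image_image)
qed

lemma add_mod_eq_iff:
  fixes a i j n :: nat
  assumes "i < n" "j < n"
  shows "(a + i) mod n = (a + j) mod n \<longleftrightarrow> i = j"
proof -
  have *: "i = j" if "(a + j) mod n = (a + i) mod n" "i \<le> j" "j < n" for i j
  proof -
    have "n dvd (a + j) - (a + i)" using that by (subst (asm) mod_eq_dvd_iff_nat) auto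
    then show ?thesis using that nat_dvd_not_less[of "j - i" n] by fastforce
  qed
  show ?thesis using *[of i j] *[of j i] assms by (metis nat_le_linear)
qed

lemma arc_less: "0 < n \<Longrightarrow> j \<in> arc n a m \<Longrightarrow> j < n"
  by (auto simp: arc_def)

lemma card_arc:
  assumes "m \<le> n"
  shows "card (arc n a m) = m"
proof -
  have "inj_on (\<lambda>k. (a + k) mod n) {..<m}"
    using assms by (intro inj_onI) (simp add: add_mod_eq_iff)
  then show ?thesis by (simp add: arc_def card_image)
qed

lemma mem_arc_iff:
  assumes "m \<le> n" "k < n"
  shows "(a + k) mod n \<in> arc n a m \<longleftrightarrow> k < m"
  using assms by (auto simp: arc_def add_mod_eq_iff)

lemma arc_full: "arc n a n = {..<n}"
proof (rule card_subset_eq)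
  show "arc n a n \<subseteq> {..<n}" by (auto simp: arc_def)
qed (simp_all add: card_arc)

text \<open>Measured from \<open>a\<close>, the arc has the offsets below \<open>m\<close>. A
  forward step leaves it only from offset \<open>m - 1\<close>, and a backward step only by wrapping
  around from offset 0 to \<open>n - 1\<close>.\<close>

lemma cycle_adjacent_arc:
  assumes "a < n" "m < n" "i \<in> arc n a m" "j \<notin> arc n a m" "j < n"
    and "j = (i + 1) mod n \<or> i = (j + 1) mod n"
  shows "i = a \<and> j = (a + n - 1) mod n \<or> i = (a + m - 1) mod n \<and> j = (a + m) mod n"
proof -
  obtain k where k: "k < m" "i = (a + k) mod n" using assms(3) by (auto simp: arc_def)
  from assms(6) show ?thesis
  proof
    assume "j = (i + 1) mod n"
    then have j: "j = (a + Suc k) mod n" using k by (simp add: mod_Suc_eq)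
    then have "\<not> Suc k < m" using mem_arc_iff[of m n "Suc k" a] assms by auto
    then have "Suc k = m" using k by simp
    then show ?thesis using j k by auto
  next
    assume i: "i = (j + 1) mod n"
    obtain h where h: "h < n" "j = (a + h) mod n"
      using assms(5) arc_full[of n a] by (auto simp: arc_def)
    have hm: "m \<le> h" using mem_arc_iff[of m n h a] h assms by auto
    have eq: "(a + k) mod n = (a + Suc h) mod n" using i k h by (simp add: mod_Suc_eq)
    \<comment> \<open>Without wrap-around, \<open>k\<close> would equal \<open>Suc h\<close> and so
      exceed \<open>m\<close>.\<close>
    have "Suc h = n"
    proof (rule ccontr)
      assume "Suc h \<noteq> n"
      then have "k = Suc h" using eq h k assms add_mod_eq_iff[of k n "Suc h" a] by auto
      then show False using hm k by simp
    qed
    then have "i = a" "j = (a + n - 1) mod n" using eq k h assms by auto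
    then show ?thesis by simp
  qed
qed

section \<open>Counting completions on the prism\<close>

lemma sum_times_singleton: "(\<Sum>w\<in>X \<times> {c}. f w) = (\<Sum>r\<in>X. f (r, c))"
proof -
  have "X \<times> {c} = (\<lambda>r. (r, c)) ` X" by auto
  then show ?thesis by (simp add: sum.reindex inj_on_def)
qed

lemma rows_end_rows:
  assumes "touching n a m S" "j \<in> arc n a m"
  shows "rows S j \<in> end_rows"
proof -
  have "rows S j \<subseteq> {0, 1}" "rows S j \<noteq> {}"
    using assms by (force simp: touching_def rows_def)+
  then show ?thesis unfolding end_rows_def by auto
qed

text \<open>Every uncovered vertex is joined by its rung to a covered one, so all orders of the
  remaining vertices are admissible.\<close>

lemma completions_all_touched:
  assumes "S \<subseteq> {0, 1} \<times> {..<n}" "snd ` S = {..<n}"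
  shows "completions (prism n) S = fact (card ({0, 1} \<times> {..<n} - S))"
  using assms
proof (induction "card ({0, 1} \<times> {..<n} - S)" arbitrary: S)
  case 0
  then have "S = {0, 1} \<times> {..<n}" by auto
  then show ?case by (simp add: completions.simps pverts_prism)
next
  case (Suc k)
  let ?V = "{0, 1::nat} \<times> {..<n}"
  have ne: "\<not> ?V \<subseteq> S" using Suc.hyps(2) by (metis Diff_eq_empty_iff card.empty nat.distinct(1))
  have bd: "boundary (prism n) S = ?V - S"
  proof (intro equalityI subsetI)
    fix w assume w: "w \<in> ?V - S"
    obtain s j where sj: "w = (s, j)" by force
    then obtain r where r: "(r, j) \<in> S" using w Suc.prems(2) by (metis DiffD1 SigmaD2 imageE prod.collapse snd_conv)
    then have "((r, j), (s, j)) \<in> parcs (prism n)"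
      using w sj Suc.prems(1) unfolding parcs_prism by auto
    then show "w \<in> boundary (prism n) S" using w r sj by (auto simp: boundary_def pverts_prism)
  qed (auto simp: boundary_def pverts_prism)
  have IH: "completions (prism n) (insert w S) = fact k" if "w \<in> ?V - S" for w
  proof -
    have "?V - insert w S = (?V - S) - {w}" by auto
    then have k: "k = card (?V - insert w S)" using Suc.hyps(2) that by simp
    have "snd ` insert w S = {..<n}" using Suc.prems that by auto
    then show ?thesis using Suc.hyps(1)[OF k] Suc.prems that k by auto
  qed
  have "completions (prism n) S = (\<Sum>w\<in>?V - S. completions (prism n) (insert w S))"
    using ne by (subst completions.simps) (simp add: bd pverts_prism)
  also have "\<dots> = (\<Sum>w\<in>?V - S. fact k)" by (rule sum.cong) (use IH in auto)
  also have "\<dots> = fact (card (?V - S))" by (simp only: sum_constant fact_Suc of_nat_id flip: Suc.hyps(2))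
  finally show ?case .
qed

lemma end_rows_subset: "A \<in> end_rows \<Longrightarrow> A \<subseteq> {0, 1}"
  unfolding end_rows_def by auto

text \<open>Rungs put every uncovered vertex of a touched column on the boundary; horizontal edges
  leave the arc only at its ends and keep the row. The two outer pieces lie in the same column when
  \<open>m = n - 1\<close>.\<close>

lemma boundary_touching:
  assumes S: "touching n a m S" and a: "a < n" and m: "1 \<le> m" "m < n"
  defines "b \<equiv> (a + m - 1) mod n"
  shows "boundary (prism n) S = {w \<in> {0, 1} \<times> {..<n} - S. snd w \<in> arc n a m} \<union>
    (rows S a \<times> {(a + n - 1) mod n} \<union> rows S b \<times> {(a + m) mod n})"
proof (intro equalityI subsetI)
  fix w assume "w \<in> boundary (prism n) S"
  then obtain v where w: "w \<in> {0, 1} \<times> {..<n} - S" and v: "v \<in> S" "(v, w) \<in> parcs (prism n)"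
    by (auto simp: boundary_def pverts_prism)
  obtain r i s j where vw: "v = (r, i)" "w = (s, j)" by force
  have i: "i \<in> arc n a m" using S v vw by (force simp: touching_def)
  show "w \<in> {w \<in> {0, 1} \<times> {..<n} - S. snd w \<in> arc n a m} \<union>
    (rows S a \<times> {(a + n - 1) mod n} \<union> rows S b \<times> {(a + m) mod n})"
  proof (cases "j \<in> arc n a m")
    case False
    \<comment> \<open>The edge changes the column, so it is horizontal.\<close>
    have e: "r = s" "j < n" "j = (i + 1) mod n \<or> i = (j + 1) mod n"
      using v vw i False unfolding vw parcs_prism by auto
    show ?thesis using cycle_adjacent_arc[OF a m(2) i False e(2,3)] v vw e(1)
      by (auto simp: rows_def b_def)
  qed (use w vw in auto)
next
  fix w assume w: "w \<in> {w \<in> {0, 1} \<times> {..<n} - S. snd w \<in> arc n a m} \<union>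
    (rows S a \<times> {(a + n - 1) mod n} \<union> rows S b \<times> {(a + m) mod n})"
  have V: "S \<subseteq> {0, 1} \<times> {..<n}" "snd ` S = arc n a m" using S by (auto simp: touching_def)
  have out: "(a + m) mod n \<notin> arc n a m" "(a + n - 1) mod n \<notin> arc n a m"
    using m mem_arc_iff[of m n m a] mem_arc_iff[of m n "n - 1" a] by auto
  have sc: "((a + n - 1) mod n + 1) mod n = a" "(b + 1) mod n = (a + m) mod n"
    using a m by (simp_all add: b_def mod_Suc_eq)
  have ends: "a \<in> arc n a m" "b \<in> arc n a m"
    using mem_arc_iff[of m n 0 a] mem_arc_iff[of m n "m - 1" a] a m by (auto simp: b_def)
  have fresh: "(r, j) \<notin> S" if "j \<notin> arc n a m" for r j using V that by force
  from w consider "w \<in> {0, 1} \<times> {..<n} - S" "snd w \<in> arc n a m"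
    | r where "w = (r, (a + n - 1) mod n)" "(r, a) \<in> S"
    | r where "w = (r, (a + m) mod n)" "(r, b) \<in> S"
    by (auto simp: rows_def)
  then show "w \<in> boundary (prism n) S"
  proof cases
    case 1
    obtain s j where sj: "w = (s, j)" by force
    then obtain r where r: "(r, j) \<in> S" using 1 V by (metis imageE prod.collapse snd_conv)
    then have "((r, j), (s, j)) \<in> parcs (prism n)"
      using 1 sj V unfolding parcs_prism by auto
    then show ?thesis using 1 r sj by (auto simp: boundary_def pverts_prism)
  next
    case 2
    have "((r, a), w) \<in> parcs (prism n)"
      using 2 V m a sc(1) out ends unfolding 2(1) parcs_prism by auto
    then show ?thesis using 2 V m out(2) fresh by (auto simp: boundary_def pverts_prism)
  next
    case 3
    have "((r, b), w) \<in> parcs (prism n)"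
      using 3 V m a sc(2) out ends unfolding 3(1) parcs_prism by auto
    then show ?thesis using 3 V m out(1) fresh by (auto simp: boundary_def pverts_prism)
  qed
qed

text \<open>The share of the boundary vertices that open a new column. The formula for longer arcs
  is an assumption, so that the result serves both inside the induction of
  \<open>completions_touching\<close> and for a single start vertex. If at least two columns are
  untouched, the left and right openings are distinct; if only one is, they coincide and
  \<open>weight_0\<close> corrects the count.\<close>

lemma outer_sum:
  assumes S: "touching n a m S" and a: "a < n" and m: "1 \<le> m" "m < n"
  defines "b \<equiv> (a + m - 1) mod n"
  assumes IH: "\<And>a' w. \<lbrakk>touching n a' (Suc m) (insert w S); a' < n; Suc m < n;
      w \<in> {0, 1} \<times> {..<n} - S\<rbrakk> \<Longrightarrow>
     real (completions (prism n) (insert w S)) = fact (card ({0, 1} \<times> {..<n} - S) - 1) *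
       weight (n - Suc m) (rows (insert w S) a') (rows (insert w S) ((a' + m) mod n))"
  shows "(\<Sum>w\<in>rows S a \<times> {(a + n - 1) mod n} \<union> rows S b \<times> {(a + m) mod n}.
      real (completions (prism n) (insert w S))) =
    fact (card ({0, 1} \<times> {..<n} - S) - 1) *
      ((\<Sum>r\<in>rows S a. weight (n - Suc m) {r} (rows S b)) +
       (\<Sum>r\<in>rows S b. weight (n - Suc m) (rows S a) {r}))"
proof -
  define p where "p = (a + n - 1) mod n"
  define q where "q = (a + m) mod n"
  let ?V = "{0, 1::nat} \<times> {..<n}"
  have V: "S \<subseteq> ?V" "snd ` S = arc n a m" using S by (auto simp: touching_def)
  have pq: "p < n" "q < n" using a by (auto simp: p_def q_def)
  have out: "p \<notin> arc n a m" "q \<notin> arc n a m"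
    using m mem_arc_iff[of m n m a] mem_arc_iff[of m n "n - 1" a] by (auto simp: p_def q_def)
  have ends: "a \<in> arc n a m" "b \<in> arc n a m"
    using mem_arc_iff[of m n 0 a] mem_arc_iff[of m n "m - 1" a] a m by (auto simp: b_def)
  have AB: "rows S a \<in> end_rows" "rows S b \<in> end_rows" using rows_end_rows[OF S] ends by auto
  have sub: "rows S a \<subseteq> {0, 1}" "rows S b \<subseteq> {0, 1}" using AB end_rows_subset by blast+
  then have fin: "finite (rows S a)" "finite (rows S b)" by (meson finite.intros finite_subset)+
  have fresh: "(r, p) \<notin> S" "(r, q) \<notin> S" for r using V out by force+
  \<comment> \<open>Extending to the left leaves the right end in place.\<close>
  have pb: "(p + m) mod n = b"
  proof -
    have "(p + m) mod n = (a + n - 1 + m) mod n" unfolding p_def by (rule mod_add_left_eq)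
    also have "a + n - 1 + m = a + m - 1 + n" using m by simp
    finally show ?thesis by (simp add: b_def)
  qed
  have rows_new: "rows (insert (r, p) S) p = {r}" "rows (insert (r, q) S) q = {r}"
     "rows (insert (r, p) S) b = rows S b" "rows (insert (r, q) S) a = rows S a" for r
    using fresh out ends by (auto simp: rows_def)
  have tp: "touching n p (Suc m) (insert (r, p) S)" if "r \<in> {0, 1}" for r
    using that V pq arc_pred[of n a m] a by (auto simp: touching_def p_def)
  have tq: "touching n a (Suc m) (insert (r, q) S)" if "r \<in> {0, 1}" for r
    using that V pq arc_Suc[of n a m] a by (auto simp: touching_def q_def)
  let ?F = "fact (card (?V - S) - 1) :: real"
  let ?c = "\<lambda>w. real (completions (prism n) (insert w S))"
  show ?thesis
  proof (cases "Suc m < n")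
    case True
    have cp: "?c (r, p) = ?F * weight (n - Suc m) {r} (rows S b)" if "r \<in> rows S a" for r
      using IH[OF tp[of r] pq(1) True] that sub pq fresh by (auto simp: pb rows_new)
    have cq: "?c (r, q) = ?F * weight (n - Suc m) (rows S a) {r}" if "r \<in> rows S b" for r
      using IH[OF tq[of r] a True] that sub pq fresh by (auto simp: rows_new simp flip: q_def)
    have "p \<noteq> q"
      using add_mod_eq_iff[of "n - 1" n m a] True by (simp add: p_def q_def)
    then have "(\<Sum>w\<in>rows S a \<times> {p} \<union> rows S b \<times> {q}. ?c w) =
        (\<Sum>r\<in>rows S a. ?c (r, p)) + (\<Sum>r\<in>rows S b. ?c (r, q))"
      using fin by (subst sum.union_disjoint) (auto simp: sum_times_singleton)
    then show ?thesis using cp cq by (simp add: p_def q_def sum_distrib_left distrib_left)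
  next
    \<comment> \<open>Only one column is untouched: both extensions enter it and complete the
      touching, so each new set has all orders admissible.\<close>
    case False
    then have n: "n = Suc m" using m by simp
    then have eq: "p = q" by (simp add: p_def q_def)
    have cq: "?c (r, q) = ?F" if "r \<in> rows S a \<union> rows S b" for r
    proof -
      have r: "r \<in> {0, 1}" using that sub by auto
      have w: "(r, q) \<in> ?V - S" using r pq fresh by auto
      have "?V - insert (r, q) S = (?V - S) - {(r, q)}" by auto
      then have card: "card (?V - insert (r, q) S) = card (?V - S) - 1" using w by simp
      have "completions (prism n) (insert (r, q) S) = fact (card (?V - insert (r, q) S))"
        using tq[OF r] arc_full[of n a] n by (intro completions_all_touched) (auto simp: touching_def)
      then show ?thesis unfolding card by simp
    qed
    have "(\<Sum>w\<in>rows S a \<times> {p} \<union> rows S b \<times> {q}. ?c w) =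
        (\<Sum>w\<in>(rows S a \<union> rows S b) \<times> {q}. ?c w)"
      by (simp add: eq Sigma_Un_distrib1)
    also have "\<dots> = (\<Sum>r\<in>rows S a \<union> rows S b. ?F)"
      unfolding sum_times_singleton by (rule sum.cong) (use cq in auto)
    also have "\<dots> = ?F * card (rows S a \<union> rows S b)" by simp
    finally show ?thesis using weight_0[OF AB] n by (simp add: p_def q_def)
  qed
qed

text \<open>Induction on the number of uncovered vertices, with \<open>weight_rec\<close> as the
  arithmetic core. The last hypothesis excludes a single half-covered column: there both ends are
  the same column, and one addition would change \<open>A\<close> and \<open>B\<close> together,
  which \<open>weight_rec\<close> does not model.\<close>

lemma completions_touching:
  assumes "touching n a m S" "a < n" "1 \<le> m" "m < n" "2 \<le> m \<or> rows S a = {0, 1}"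
  shows "real (completions (prism n) S) = fact (card ({0, 1} \<times> {..<n} - S)) *
    weight (n - m) (rows S a) (rows S ((a + m - 1) mod n))"
  using assms
proof (induction "card ({0, 1} \<times> {..<n} - S)" arbitrary: S a m rule: less_induct)
  case less
  note S = less.prems(1) and a = less.prems(2) and m = less.prems(3,4) and wide = less.prems(5)
  define b where "b = (a + m - 1) mod n"
  define A where "A = rows S a"
  define B where "B = rows S b"
  define u where "u = n - m"
  let ?V = "{0, 1::nat} \<times> {..<n}"
  have V: "S \<subseteq> ?V" "snd ` S = arc n a m" using S by (auto simp: touching_def)
  have ends: "a \<in> arc n a m" "b \<in> arc n a m"
    using mem_arc_iff[of m n 0 a] mem_arc_iff[of m n "m - 1" a] a m by (auto simp: b_def)
  have ends_less: "a < n" "b < n" using a by (auto simp: b_def)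
  have AB: "A \<in> end_rows" "B \<in> end_rows"
    using rows_end_rows[OF S] ends by (auto simp: A_def B_def)
  \<comment> \<open>If the two ends coincide, that column is full, so no missing vertex is counted
    for both ends.\<close>
  have ab: "a \<noteq> b \<or> A = {0, 1} \<and> B = {0, 1}"
  proof (cases "a = b")
    case True
    then have "m = 1" using add_mod_eq_iff[of 0 n "m - 1" a] m a by (simp add: b_def)
    then have "rows S a = {0, 1}" using wide by simp
    then show ?thesis using True unfolding A_def B_def by simp
  qed simp
  let ?F = "fact (card (?V - S) - 1) :: real"
  let ?c = "\<lambda>w. real (completions (prism n) (insert w S))"
  have card_less: "card (?V - insert w S) = card (?V - S) - 1" "card (?V - insert w S) < card (?V - S)"
    if "w \<in> ?V - S" for w
  proof -
    have "?V - insert w S = (?V - S) - {w}" by auto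
    then show *: "card (?V - insert w S) = card (?V - S) - 1" using that by simp
    have "card (?V - S) > 0" using that by (auto simp: card_gt_0_iff)
    then show "card (?V - insert w S) < card (?V - S)" using * by simp
  qed
  \<comment> \<open>The boundary splits into \<open>M\<close>, inside touched columns, and
    \<open>X\<close>, opening new ones. Later \<open>M\<close> is split into the missing vertices
    \<open>Ma\<close>, \<open>Mb\<close> of the end columns and the rest \<open>M0\<close>, which
    does not affect the weight.\<close>
  define M where "M = {w \<in> ?V - S. snd w \<in> arc n a m}"
  define X where "X = A \<times> {(a + n - 1) mod n} \<union> B \<times> {(a + m) mod n}"
  have outer: "(\<Sum>w\<in>X. ?c w) =
      ?F * ((\<Sum>r\<in>A. weight (n - Suc m) {r} B) + (\<Sum>r\<in>B. weight (n - Suc m) A {r}))"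
    unfolding X_def A_def B_def b_def
  proof (rule outer_sum[OF S a m])
    fix a' w
    assume t: "touching n a' (Suc m) (insert w S)" "a' < n" "Suc m < n" "w \<in> ?V - S"
    show "?c w = ?F * weight (n - Suc m) (rows (insert w S) a') (rows (insert w S) ((a' + m) mod n))"
      using less.hyps[OF card_less(2)[OF t(4)] t(1,2) _ t(3)] m card_less(1)[OF t(4)]
      by simp
  qed
  have inner: "?c w = ?F * weight u (rows (insert w S) a) (rows (insert w S) b)" if "w \<in> M" for w
  proof -
    have w: "w \<in> ?V - S" using that by (simp add: M_def)
    have t: "touching n a m (insert w S)" using V that by (auto simp: touching_def M_def)
    have "rows (insert w S) a = {0, 1}" if "rows S a = {0, 1}"
    proof -
      have "rows S a \<subseteq> rows (insert w S) a" by (auto simp: rows_def)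
      then show ?thesis using end_rows_subset[OF rows_end_rows[OF t ends(1)]] that by blast
    qed
    then have "2 \<le> m \<or> rows (insert w S) a = {0, 1}" using wide by blast
    from less.hyps[OF card_less(2)[OF w] t a m this] card_less(1)[OF w]
    show ?thesis by (simp add: b_def u_def)
  qed
  define Ma where "Ma = ({0, 1} - A) \<times> {a}"
  define Mb where "Mb = ({0, 1} - B) \<times> {b}"
  define M0 where "M0 = {w \<in> M. snd w \<noteq> a \<and> snd w \<noteq> b}"
  have finM: "finite M" "finite Ma" "finite Mb" "finite M0"
    by (auto simp: M_def Ma_def Mb_def M0_def)
  have M: "M = M0 \<union> (Ma \<union> Mb)"
    using ends ends_less by (auto simp: M_def M0_def Ma_def Mb_def A_def B_def rows_def)
  have disj: "M0 \<inter> (Ma \<union> Mb) = {}" "Ma \<inter> Mb = {}"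
    using ab by (auto simp: M0_def Ma_def Mb_def)
  have cM: "real (card M) = card M0 + card ({0, 1} - A) + card ({0, 1} - B)"
  proof -
    have "card M = card M0 + (card Ma + card Mb)"
      unfolding M using disj finM by (simp add: card_Un_disjoint)
    then show ?thesis by (simp add: Ma_def Mb_def card_cartesian_product)
  qed
  \<comment> \<open>Each of the \<open>u\<close> untouched columns contributes two uncovered
    vertices.\<close>
  have cV: "card (?V - S) = card M + 2 * u"
  proof -
    have "?V - S = M \<union> {0, 1} \<times> ({..<n} - arc n a m)" using V by (force simp: M_def)
    moreover have "M \<inter> {0, 1} \<times> ({..<n} - arc n a m) = {}" by (auto simp: M_def)
    moreover have "card ({..<n} - arc n a m) = u"
    proof -
      have "arc n a m \<subseteq> {..<n}" using arc_less[of n _ a m] m by auto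
      moreover have "finite (arc n a m)" by (simp add: arc_def)
      ultimately show ?thesis using card_arc[of m n a] m by (simp add: card_Diff_subset u_def)
    qed
    ultimately show ?thesis using finM by (simp add: card_Un_disjoint card_cartesian_product)
  qed
  have u: "u = Suc (n - Suc m)" using m by (simp add: u_def)
  have s0: "(\<Sum>w\<in>M0. ?c w) = ?F * (card M0 * weight u A B)"
  proof -
    have "?c w = ?F * weight u A B" if "w \<in> M0" for w
    proof -
      have "rows (insert w S) a = A" "rows (insert w S) b = B"
        using that by (auto simp: M0_def rows_def A_def B_def)
      then show ?thesis using inner[of w] that by (simp add: M0_def)
    qed
    then show ?thesis by simp
  qed
  have sa: "(\<Sum>w\<in>Ma. ?c w) = ?F * (\<Sum>r\<in>{0, 1} - A. weight u (insert r A) B)"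
    unfolding Ma_def sum_times_singleton sum_distrib_left
  proof (rule sum.cong[OF refl])
    fix r assume r: "r \<in> {0, 1} - A"
    then have "rows (insert (r, a) S) a = insert r A" "rows (insert (r, a) S) b = B"
      using ab by (auto simp: rows_def A_def B_def)
    moreover have "(r, a) \<in> M" using r M by (auto simp: Ma_def)
    ultimately show "?c (r, a) = ?F * weight u (insert r A) B" using inner by simp
  qed
  have sb: "(\<Sum>w\<in>Mb. ?c w) = ?F * (\<Sum>r\<in>{0, 1} - B. weight u A (insert r B))"
    unfolding Mb_def sum_times_singleton sum_distrib_left
  proof (rule sum.cong[OF refl])
    fix r assume r: "r \<in> {0, 1} - B"
    then have "rows (insert (r, b) S) b = insert r B" "rows (insert (r, b) S) a = A"
      using ab by (auto simp: rows_def A_def B_def)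
    moreover have "(r, b) \<in> M" using r M by (auto simp: Mb_def)
    ultimately show "?c (r, b) = ?F * weight u A (insert r B)" using inner by simp
  qed
  have ne: "\<not> ?V \<subseteq> S"
    using cV u by (metis Diff_eq_empty_iff add_is_0 card.empty mult_is_0 nat.distinct(1) zero_neq_numeral)
  have bd: "boundary (prism n) S = M \<union> X"
    using boundary_touching[OF S a m] by (simp add: M_def X_def A_def B_def b_def)
  have "(a + m) mod n \<notin> arc n a m" "(a + n - 1) mod n \<notin> arc n a m"
    using m mem_arc_iff[of m n m a] mem_arc_iff[of m n "n - 1" a] by auto
  then have MX: "M \<inter> X = {}" using m by (auto simp: M_def X_def)
  have "finite A" "finite B"
    using AB end_rows_subset by (meson finite.intros finite_subset)+
  then have finX: "finite X" by (simp add: X_def)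
  have "real (completions (prism n) S) = (\<Sum>w\<in>M \<union> X. ?c w)"
    using ne by (subst completions.simps) (simp add: bd pverts_prism)
  also have "\<dots> = (\<Sum>w\<in>M0. ?c w) + (\<Sum>w\<in>Ma. ?c w) + (\<Sum>w\<in>Mb. ?c w) + (\<Sum>w\<in>X. ?c w)"
    using MX finX finM disj by (simp add: sum.union_disjoint M)
  \<comment> \<open>The terms from \<open>Ma\<close>, \<open>Mb\<close> and \<open>X\<close> form
    the right-hand side of \<open>weight_rec\<close>; with those from \<open>M0\<close>, the
    coefficient becomes the number of all uncovered vertices.\<close>
  also have "\<dots> = ?F * (card M0 * weight u A B +
      (2 * real u + card ({0, 1} - A) + card ({0, 1} - B)) * weight u A B)"
    unfolding s0 sa sb outer u weight_rec[OF AB] by (simp add: algebra_simps)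
  also have "\<dots> = ?F * (real (card (?V - S)) * weight u A B)"
    using cV cM by (simp add: algebra_simps)
  also have "\<dots> = fact (card (?V - S)) * weight u A B"
    using cV u by (simp add: fact_reduce)
  finally show ?case by (simp add: u_def A_def B_def b_def)
qed

text \<open>This start is the case excluded in \<open>completions_touching\<close>, so the first
  addition is made by hand: the rung neighbour fills the column, and a side neighbour gives an arc
  of two columns with equal ends \<open>{r}\<close>. For \<open>n = 2\<close> the two side
  neighbours coincide, which \<open>outer_sum\<close> takes into account.\<close>

lemma completions_singleton:
  assumes n: "n \<ge> 2" and r: "r \<in> {0, 1}" and a: "a < n"
  shows "real (completions (prism n) {(r, a)}) = (real n + 2) * fact (2 * n - 2) / (2 * fact (n - 2))"
proof -
  let ?V = "{0, 1::nat} \<times> {..<n}"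
  define S where "S = {(r, a)}"
  have arc1: "arc n a 1 = {a}" using a by (auto simp: arc_def)
  have S: "touching n a 1 S" using r a arc1 by (auto simp: touching_def S_def)
  have m: "1 \<le> (1::nat)" "1 < n" using n by auto
  have rowsS: "rows S a = {r}" by (auto simp: rows_def S_def)
  have amod: "(a + 1 - 1) mod n = a" using a by simp
  have cV: "card (?V - S) = 2 * n - 1"
    using r a by (subst card_Diff_subset) (auto simp: S_def card_cartesian_product)
  have card_ins: "card (?V - insert w S) = card (?V - S) - 1" if "w \<in> ?V - S" for w
  proof -
    have "?V - insert w S = (?V - S) - {w}" by auto
    then show ?thesis using that by simp
  qed
  let ?c = "\<lambda>w. real (completions (prism n) (insert w S))"
  define X where "X = rows S a \<times> {(a + n - 1) mod n} \<union> rows S a \<times> {(a + 1) mod n}"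
  have outer: "(\<Sum>w\<in>X. ?c w) = fact (2 * n - 2) * (2 * weight (n - 2) {r} {r})"
  proof -
    have "(\<Sum>w\<in>X. ?c w) = fact (card (?V - S) - 1) *
      ((\<Sum>r\<in>rows S a. weight (n - Suc 1) {r} (rows S a)) +
       (\<Sum>r\<in>rows S a. weight (n - Suc 1) (rows S a) {r}))"
      unfolding X_def
    proof (rule outer_sum[OF S a m, unfolded amod])
      fix a' w
      assume t: "touching n a' (Suc 1) (insert w S)" "a' < n" "Suc 1 < n" "w \<in> ?V - S"
      show "?c w = fact (card (?V - S) - 1) *
          weight (n - Suc 1) (rows (insert w S) a') (rows (insert w S) ((a' + 1) mod n))"
        using completions_touching[OF t(1,2) _ t(3)] card_ins[OF t(4)] by simp
    qed
    moreover have "n - Suc 1 = n - 2" "2 * n - 1 - 1 = 2 * n - 2" by simp_all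
    ultimately show ?thesis unfolding cV rowsS by simp
  qed
  have w: "(1 - r, a) \<in> ?V - S" using r a by (auto simp: S_def)
  have full: "rows (insert (1 - r, a) S) a = {0, 1}" using r by (auto simp: rows_def S_def)
  have "touching n a 1 (insert (1 - r, a) S)" using w r a arc1 by (auto simp: touching_def S_def)
  moreover have "2 * n - 1 - 1 = 2 * n - 2" by simp
  ultimately have inner: "?c (1 - r, a) = fact (2 * n - 2) * weight (n - 1) {0, 1} {0, 1}"
    using completions_touching[of n a 1 "insert (1 - r, a) S"] a m
    by (simp only: full amod card_ins[OF w] cV simp_thms)
  have M: "{w \<in> ?V - S. snd w \<in> arc n a 1} = {(1 - r, a)}"
    unfolding arc1 using r a by (auto simp: S_def)
  have bd: "boundary (prism n) S = {(1 - r, a)} \<union> X"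
    using boundary_touching[OF S a m, unfolded amod M] by (simp add: X_def)
  have "(a + 1) mod n \<noteq> a" "(a + n - 1) mod n \<noteq> a"
    using add_mod_eq_iff[of 1 n 0 a] add_mod_eq_iff[of "n - 1" n 0 a] a n by auto
  then have "(1 - r, a) \<notin> X" by (auto simp: X_def)
  moreover have "finite X" by (simp add: X_def rowsS)
  moreover have "\<not> ?V \<subseteq> S" using w by auto
  ultimately have "real (completions (prism n) S) = ?c (1 - r, a) + (\<Sum>w\<in>X. ?c w)"
    by (subst completions.simps) (simp add: bd pverts_prism)
  also have "\<dots> = fact (2 * n - 2) * (weight (n - 1) {0, 1} {0, 1} + 2 * weight (n - 2) {r} {r})"
    unfolding inner outer by (simp add: algebra_simps)
  also have "\<dots> = (real n + 2) * fact (2 * n - 2) / (2 * fact (n - 2))"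
  proof -
    \<comment> \<open>With \<open>n = k + 2\<close>, the first weight is 1 / k! and twice the second
      is n / (2 k!).\<close>
    obtain k where k: "n = Suc (Suc k)" using n by (metis add_2_eq_Suc le_Suc_ex)
    show ?thesis unfolding k by (simp add: weight_def divide_simps)
  qed
  finally show ?thesis by (simp add: S_def)
qed

theorem theorem7:
  fixes n :: nat
  assumes "n \<ge> 2"
  shows "real (num_rw_labelings (cart_prod (cycle_graph 2) (cycle_graph n))) =
         real n * (real n + 2) * fact (2 * n - 2) / fact (n - 2)"
proof -
  have "pair_graph (prism n)" by (intro pair_graph_cart_prod pair_graph_cycle_graph)
  then have "real (num_rw_labelings (prism n)) =
      (\<Sum>v\<in>{0, 1} \<times> {..<n}. real (completions (prism n) {v}))"
    by (simp add: num_rw_labelings_eq pverts_prism)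
  also have "\<dots> = (\<Sum>v\<in>{0, 1::nat} \<times> {..<n}. (real n + 2) * fact (2 * n - 2) / (2 * fact (n - 2)))"
    by (rule sum.cong) (use completions_singleton[OF assms] in auto)
  \<comment> \<open>There are 2n start vertices with equal contributions, and the factor 2 cancels
    the one in the denominator.\<close>
  also have "\<dots> = real n * (real n + 2) * fact (2 * n - 2) / fact (n - 2)"
    by (simp add: card_cartesian_product)
  finally show ?thesis .
qed

end
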